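(* Let $m\ge 2$ be an integer and let $\{x_i\}$ be a non-decreasing sequence of real knots. Let $j$ be an index with $0<x_{j+m}-x_j<\frac{2\pi h}{\ln(1+h)}$. Then the $h$-trigonometric B-splines satisfy, for real $x$, the recurrence relation $$T_{j,m}(x;h)=\frac{\sin_h\frac{x-(m-2)h-x_j}{2}}{\sin_h\frac{x_{j+m}-x_j}{2}}\,T_{j,m-1}(x;h)+\frac{\sin_h\frac{x_{j+m}-x+(m-2)h}{2}}{\sin_h\frac{x_{j+m}-x_j}{2}}\,T_{j+1,m-1}(x;h).$$
   Context: Fix a real number $h\neq 0$, $h>-1$. For real $x$ put $e_h^{ix}=(1+h)^{ix/h}=\exp\left(ix\frac{\ln(1+h)}{h}\right)$, $\cos_h x=\frac{e_h^{ix}+e_h^{-ix}}{2}$, $\sin_h x=\frac{e_h^{ix}-e_h^{-ix}}{2i}$. For functions $\varphi_0,\dots,\varphi_m$ and points $x_0,\dots,x_m$, $\det\begin{pmatrix}\varphi_0&\cdots&\varphi_m\\ x_0&\cdots&x_m\end{pmatrix}$ denotes the determinant of the matrix whose row $r$ is $(\varphi_0(x_r),\dots,\varphi_m(x_r))$, $r=0,\dots,m$. $h$-trigonometric divided difference: for $m\ge1$, $x_0<\cdots<x_m$ with $x_m-x_0<\frac{2\pi h}{\ln(1+h)}$ and a function $f$ defined at the nodes, $$[x_0,\ldots,x_m;h]_t f=2^{m-1}\frac{\det\begin{pmatrix}1&\cos_h x&\sin_h x&\cdots&\cos_h nx&\sin_h nx&f(x)\\ x_0&x_1&x_2&\cdots&x_{m-2}&x_{m-1}&x_m\end{pmatrix}}{\det\begin{pmatrix}\cos_h\frac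 x2&\sin_h\frac x2&\cdots&\cos_h(n+\frac12)x&\sin_h(n+\frac12)x\\ x_0&x_1&\cdots&x_{m-1}&x_m\end{pmatrix}}\quad\text{if } m=2n+1,$$ $$[x_0,\ldots,x_m;h]_t f=2^{m}\frac{\det\begin{pmatrix}\cos_h\frac x2&\sin_h\frac x2&\cdots&\cos_h(n-\frac12)x&\sin_h(n-\frac12)x&f(x)\\ x_0&x_1&\cdots&x_{m-2}&x_{m-1}&x_m\end{pmatrix}}{\det\begin{pmatrix}1&\cos_h x&\sin_h x&\cdots&\cos_h nx&\sin_h nx\\ x_0&x_1&x_2&\cdots&x_{m-1}&x_m\end{pmatrix}}\quad\text{if } m=2n.$$ If some (not all) of the nodes coincide, the divided difference is read as the limit of its values at distinct nodes that approach the given ones from the left. $h$-truncated power: for $m\ge 1$, $\left(\sin_h\frac{y-x}{2}\right)_+^{m-1}=\prod_{l=0}^{m-2}\sin_h\left(\frac{y-(x-lh)}{2}\right)$ if $y>x$, and $0$ if $y\le x$ (the empty product, for $m=1$, is $1$). $h$-trigonometric B-splines: for $m\ge1$, $T_{j,m}(x;h)\equiv0$ if $x_{j+m}=x_j$, and if $x_{j+m}>x_j$, $T_{j,m}(x;h)=[x_j,\ldots,x_{j+m};h]_t\left(\sin_h\frac{y-x}{2}\right)_+^{m-1}$, the divided difference being taken with respect to $y$. In particular, if $x_{j+1}>x_j$, $T_{j,1}(x;h)=1/\sin_h\left(\frac{x_{j+1}-x_j}{2}\right)$ if $x_j\le x<x_{j+1}$ and $0$ otherwise. *)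

theory Defs
  imports Complex_Main "Jordan_Normal_Form.Determinant"
begin

text \<open>\<open>exp_h h x\<close> is \<open>e_h^{ix} = (1 + h)^{ix/h}\<close>; the factor \<open>\<i>\<close> is built in, so that
  \<open>e_h^{-ix}\<close> is \<open>exp_h h (- x)\<close>.\<close>

definition exp_h :: "real \<Rightarrow> real \<Rightarrow> complex" where
  "exp_h h x = exp (\<i> * complex_of_real (x * (ln (1 + h) / h)))"

text \<open>The defining expressions are complex-valued but real; taking \<open>Re\<close> only fixes the type
  (see \<open>of_real_cos_h\<close> and \<open>of_real_sin_h\<close>).\<close>

definition cos_h :: "real \<Rightarrow> real \<Rightarrow> real" where
  "cos_h h x = Re ((exp_h h x + exp_h h (- x)) / 2)"

definition sin_h :: "real \<Rightarrow> real \<Rightarrow> real" where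
  "sin_h h x = Re ((exp_h h x - exp_h h (- x)) / (2 * \<i>))"

lemma of_real_cos_h: "complex_of_real (cos_h h x) = (exp_h h x + exp_h h (- x)) / 2"
  by (simp add: complex_eq_iff cos_h_def exp_h_def Re_exp Im_exp)

lemma of_real_sin_h: "complex_of_real (sin_h h x) = (exp_h h x - exp_h h (- x)) / (2 * \<i>)"
  by (simp add: complex_eq_iff sin_h_def exp_h_def Re_exp Im_exp Re_divide Im_divide)

definition colloc_det :: "(nat \<Rightarrow> real \<Rightarrow> real) \<Rightarrow> nat \<Rightarrow> (nat \<Rightarrow> real) \<Rightarrow> real" where
  "colloc_det \<phi> m x = det (mat (Suc m) (Suc m) (\<lambda>(r, c). \<phi> c (x r)))"

text \<open>The system \<open>1, cos_h y, sin_h y, cos_h 2y, sin_h 2y, \<dots>\<close>, numbered from 0.\<close>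

definition trig_int :: "real \<Rightarrow> nat \<Rightarrow> real \<Rightarrow> real" where
  "trig_int h k y =
     (if k = 0 then 1
      else if odd k then cos_h h (real ((k + 1) div 2) * y)
      else sin_h h (real (k div 2) * y))"

text \<open>The system \<open>cos_h (y/2), sin_h (y/2), cos_h (3y/2), sin_h (3y/2), \<dots>\<close>, numbered from 0.\<close>

definition trig_half :: "real \<Rightarrow> nat \<Rightarrow> real \<Rightarrow> real" where
  "trig_half h k y =
     (if even k then cos_h h ((real (k div 2) + 1/2) * y)
      else sin_h h ((real (k div 2) + 1/2) * y))"

text \<open>The divided difference at pairwise distinct nodes \<open>x 0 < \<dots> < x m\<close>. In the numerators the
  last column \<open>m\<close> is replaced by \<open>f\<close>.\<close>

definition trig_dd_distinct :: "real \<Rightarrow> nat \<Rightarrow> (nat \<Rightarrow> real) \<Rightarrow> (real \<Rightarrow> real) \<Rightarrow> real" where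
  "trig_dd_distinct h m x f =
     (if odd m
      then 2 ^ (m - 1) * (colloc_det ((trig_int h)(m := f)) m x / colloc_det (trig_half h) m x)
      else 2 ^ m * (colloc_det ((trig_half h)(m := f)) m x / colloc_det (trig_int h) m x))"

text \<open>Tuples of distinct (increasing) nodes \<open>y 0 < \<dots> < y m\<close> in which every \<open>y i\<close> tends to \<open>x i\<close>
  from the left.\<close>

definition left_nodes :: "nat \<Rightarrow> (nat \<Rightarrow> real) \<Rightarrow> (nat \<Rightarrow> real) filter" where
  "left_nodes m x =
     inf (INF i\<in>{..m}. filtercomap (\<lambda>y. y i) (at_left (x i)))
         (principal {y. strict_mono_on {..m} y})"

definition trig_dd :: "real \<Rightarrow> nat \<Rightarrow> (nat \<Rightarrow> real) \<Rightarrow> (real \<Rightarrow> real) \<Rightarrow> real" where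
  "trig_dd h m x f =
     (if strict_mono_on {..m} x then trig_dd_distinct h m x f
      else Lim (left_nodes m x) (\<lambda>y. trig_dd_distinct h m y f))"

text \<open>\<open>trunc_sin_h h p x y\<close> is the truncated power of exponent \<open>p\<close>, i.e. \<open>p = m - 1\<close> and the
  product runs over \<open>l = 0, \<dots>, m - 2\<close>.\<close>

definition trunc_sin_h :: "real \<Rightarrow> nat \<Rightarrow> real \<Rightarrow> real \<Rightarrow> real" where
  "trunc_sin_h h p x y =
     (if y > x then \<Prod>l<p. sin_h h ((y - (x - real l * h)) / 2) else 0)"

text \<open>\<open>trig_bspline h x j m t\<close> is \<open>T_{j,m}(t;h)\<close> for the knot sequence \<open>x\<close> and order \<open>m \<ge> 1\<close>.\<close>

definition trig_bspline :: "real \<Rightarrow> (int \<Rightarrow> real) \<Rightarrow> int \<Rightarrow> nat \<Rightarrow> real \<Rightarrow> real" where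
  "trig_bspline h x j m t =
     (if x (j + int m) = x j then 0
      else trig_dd h m (\<lambda>i. x (j + int i)) (trunc_sin_h h (m - 1) t))"

end

theory Submission
  imports Defs
begin

text \<open>
  After the substitution \<open>\<theta> = x ln (1 + h) / h\<close>, the \<open>h\<close>-trigonometric functions are the ordinary
  ones, and the proof rests on a Lagrange form of the divided difference at distinct nodes,
  \<open>\<Sum>i\<le>m. f (x i) / (\<Prod>k\<noteq>i. sin_h ((x i - x k) / 2))\<close>, which does not depend on the parity of \<open>m\<close>
  (lemma \<open>trig_dd_distinct_eq_sum\<close>). It comes from evaluating the collocation determinants of both
  trigonometric systems as Vandermonde-like products of half-angle sines, and these in turn from the
  same systems written in exponentials: a determinant with exponential columns is a polynomial in the
  exponential of its last node, and its zeros are known (lemma \<open>exp_det_Suc\<close>).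

  Given the Lagrange form, the recurrence at distinct nodes is a Leibniz rule: the truncated power of
  order \<open>m\<close> is that of order \<open>m - 1\<close> times \<open>sin_h ((y - a) / 2)\<close> with \<open>a = t - (m - 2) h\<close>, and at
  every node the two sides agree by a three-term identity between sines (lemma
  \<open>trig_dd_distinct_recurrence\<close>).

  For coinciding knots, the recurrence is first used to show that the limits exist at all. If the end
  knots differ, the divided difference of order \<open>m\<close> at nearby distinct nodes is a combination, with
  convergent coefficients, of two divided differences of order \<open>m - 1\<close>, so that induction applies; if all
  the knots coincide, the divided difference is eventually zero, because the truncated power is
  close to the knot, on its left, a function that the divided difference annihilates. Hence every B-spline,
  including those that are zero by convention, is a limit along increasing nodes that approach the
  knots from the left (lemma \<open>tendsto_trig_dd\<close>), and the theorem is the limit of the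
  recurrence at distinct nodes.
\<close>

section \<open>Determinants\<close>

text \<open>Both sides are polynomials in \<open>z\<close> of degree at most \<open>m\<close>. They agree at the
  \<open>m\<close> nodes, where both vanish, and at \<open>0\<close>, where only the constant term \<open>C m\<close> survives. With \<open>C\<close>
  the cofactors of a last row, this factors a generalized Vandermonde determinant. Normalizing by
  the constant term rather than by the leading coefficient puts the weight on one prescribed column.\<close>

lemma sum_powers_vanishing_at_nodes:
  fixes C s :: "nat \<Rightarrow> complex" and b :: "nat \<Rightarrow> nat" and z :: complex
  assumes inj: "inj_on s {..<m}" and nz: "\<And>k. k < m \<Longrightarrow> s k \<noteq> 0"
    and van: "\<And>k. k < m \<Longrightarrow> (\<Sum>c\<le>m. C c * s k ^ b c) = 0"
    and bm: "b m = 0" and b: "\<And>c. c < m \<Longrightarrow> 0 < b c \<and> b c \<le> m"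
  shows "(\<Sum>c\<le>m. C c * z ^ b c) = C m * (\<Prod>k<m. 1 - z / s k)"
proof -
  define p where "p = (\<Sum>c\<le>m. monom (C c) (b c))"
  define q where "q = smult (C m) (\<Prod>k<m. [:1, - 1 / s k:])"
  have poly_p: "poly p w = (\<Sum>c\<le>m. C c * w ^ b c)" for w
    by (simp add: p_def poly_sum poly_monom)
  have poly_q: "poly q w = C m * (\<Prod>k<m. 1 - w / s k)" for w
    by (simp add: q_def poly_prod)
  have "p = q"
  proof (rule poly_eqI_degree)
    fix w assume "w \<in> insert 0 (s ` {..<m})"
    then consider "w = 0" | k where "k < m" "w = s k" by auto
    then show "poly p w = poly q w"
    proof cases
      case 1
      have "(\<Sum>c\<le>m. C c * 0 ^ b c) = (\<Sum>c\<in>{m}. C c * 0 ^ b c)"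
      proof (intro sum.mono_neutral_right ballI)
        show "C c * 0 ^ b c = 0" if "c \<in> {..m} - {m}" for c
          using b[of c] that by simp
      qed auto
      then show ?thesis using 1 by (simp add: poly_p poly_q bm)
    next
      case 2
      have "(\<Prod>i<m. 1 - w / s i) = 0"
        using 2 nz by (intro prod_zero) auto
      then show ?thesis using 2 van by (simp add: poly_p poly_q)
    qed
  next
    have card: "card (insert 0 (s ` {..<m})) = Suc m"
      using nz inj by (subst card_insert_disjoint) (auto simp: card_image)
    have "b c \<le> m" if "c \<le> m" for c
      using that b[of c] bm by (cases "c = m") simp_all
    then have "degree p \<le> m" unfolding p_def
      by (intro degree_sum_le) (auto intro: order.trans[OF degree_monom_le])
    then show "card (insert 0 (s ` {..<m})) > degree p" using card by simp
    have "degree (\<Prod>k<m. [:1, - 1 / s k:]) \<le> (\<Sum>k<m. degree [:1, - 1 / s k:])"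
      using degree_prod_sum_le[of "{..<m}" "\<lambda>k. [:1, - 1 / s k:]"] by (simp add: o_def)
    also have "\<dots> \<le> (\<Sum>k<m. 1)" by (intro sum_mono) simp
    finally have "degree q \<le> m" by (simp add: q_def)
    then show "card (insert 0 (s ` {..<m})) > degree q" using card by simp
  qed
  then show ?thesis using poly_p poly_q by metis
qed

lemma det_scale_rows:
  fixes d :: "nat \<Rightarrow> 'a :: comm_ring_1"
  shows "det (mat n n (\<lambda>(r, c). d r * A r c)) = (\<Prod>r<n. d r) * det (mat n n (\<lambda>(r, c). A r c))"
proof -
  have "(\<Prod>i = 0..<n. mat n n (\<lambda>(r, c). d r * A r c) $$ (i, p i))
      = (\<Prod>r<n. d r) * (\<Prod>i = 0..<n. mat n n (\<lambda>(r, c). A r c) $$ (i, p i))"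
    if "p permutes {0..<n}" for p
    using permutes_in_image[OF that] by (simp add: prod.distrib atLeast0LessThan)
  then show ?thesis
    by (simp add: det_def sum_distrib_left mult.left_commute)
qed

text \<open>The coefficients \<open>C\<close> depend only on the other rows, so that the determinant becomes a
  function of its last node, to which the preceding lemma applies.\<close>

lemma det_last_row:
  fixes A :: "nat \<Rightarrow> nat \<Rightarrow> 'a :: comm_ring_1"
  obtains C where "\<And>v. det (mat (Suc m) (Suc m) (\<lambda>(r, c). if r = m then v c else A r c)) = (\<Sum>c\<le>m. C c * v c)"
    and "C m = det (mat m m (\<lambda>(r, c). A r c))"
proof
  define C where "C c = (-1) ^ (m + c) * det (mat m m (\<lambda>(r, c'). A r (if c' < c then c' else Suc c')))" for c
  show "det (mat (Suc m) (Suc m) (\<lambda>(r, c). if r = m then v c else A r c)) = (\<Sum>c\<le>m. C c * v c)" for v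
  proof -
    let ?B = "mat (Suc m) (Suc m) (\<lambda>(r, c). if r = m then v c else A r c)"
    have "mat_delete ?B m c = mat m m (\<lambda>(r, c'). A r (if c' < c then c' else Suc c'))" if "c \<le> m" for c
      using that by (auto simp: mat_delete_def)
    then have "det ?B = (\<Sum>c<Suc m. ?B $$ (m, c) * C c)"
      by (subst laplace_expansion_row[of _ "Suc m" m]) (auto simp: cofactor_def C_def intro!: sum.cong)
    also have "\<dots> = (\<Sum>c\<le>m. C c * v c)"
      by (intro sum.cong) (auto simp: mult.commute)
    finally show ?thesis .
  qed
  show "C m = det (mat m m (\<lambda>(r, c). A r c))"
    unfolding C_def mult_2[symmetric] 
    by (auto intro!: arg_cong[where f = det])
qed

text \<open>Peels a trailing block of size two off a block diagonal matrix; used to evaluate the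
  matrix that turns pairs of exponentials into cosine and sine.\<close>

lemma det_mat_block:
  fixes f :: "nat \<times> nat \<Rightarrow> 'a :: idom"
  assumes "\<And>i j. i < n \<Longrightarrow> n \<le> j \<Longrightarrow> j \<le> Suc n \<Longrightarrow> f (i, j) = 0"
    and "\<And>i j. i < n \<Longrightarrow> n \<le> j \<Longrightarrow> j \<le> Suc n \<Longrightarrow> f (j, i) = 0"
  shows "det (mat (Suc (Suc n)) (Suc (Suc n)) f)
    = det (mat n n f) * (f (n, n) * f (Suc n, Suc n) - f (n, Suc n) * f (Suc n, n))"
proof -
  let ?B = "mat 2 2 (\<lambda>(i, j). f (n + i, n + j))"
  have "mat (Suc (Suc n)) (Suc (Suc n)) f = four_block_mat (mat n n f) (0\<^sub>m n 2) (0\<^sub>m 2 n) ?B"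
    by (rule eq_matI) (use assms in auto)
  then have 1: "det (mat (Suc (Suc n)) (Suc (Suc n)) f) = det (mat n n f) * det ?B"
    by (simp only:) (rule det_four_block_mat_upper_right_zero[OF _ refl], auto)
  have "det ?B = (\<Sum>j<2. ?B $$ (0, j) * cofactor ?B 0 j)"
    by (subst laplace_expansion_row[of _ 2 0]) auto
  also have "\<dots> = f (n, n) * f (Suc n, Suc n) - f (n, Suc n) * f (Suc n, n)"
    by (simp add: numeral_2_eq_2 cofactor_def det_single mat_delete_def)
  finally show ?thesis using 1 by simp
qed

section \<open>The exponential system\<close>

definition parity_sign :: "nat \<Rightarrow> real" where "parity_sign m = (if even m then 1 else - 1)"

text \<open>For even \<open>m\<close> these are \<open>0, 1, -1, 2, -2, \<dots>\<close>, for odd \<open>m\<close> they are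
  \<open>-1/2, 1/2, -3/2, 3/2, \<dots>\<close>. In this order, the exponents for \<open>m\<close> are those for \<open>m - 1\<close>, shifted
  by \<open>parity_sign m / 2\<close>, and followed by one new exponent. Thus a shift of all frequencies, which
  only rescales the rows of a determinant, joins the integer and the half-integer system.\<close>

definition exponent :: "nat \<Rightarrow> nat \<Rightarrow> real" where
  "exponent m c = parity_sign m * (if even (m + c) then - (real c / 2) else real (c + 1) / 2)"

definition exp_det :: "nat \<Rightarrow> (nat \<Rightarrow> real) \<Rightarrow> complex" where
  "exp_det m \<theta> = det (mat (Suc m) (Suc m) (\<lambda>(r, c). cis (exponent m c * \<theta> r)))"

lemma one_minus_cis: "1 - cis u = - 2 * \<i> * cis (u / 2) * of_real (sin (u / 2))"
proof -
  have "cos u = 1 - 2 * sin (u / 2) * sin (u / 2)" "sin u = 2 * sin (u / 2) * cos (u / 2)"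
    using cos_double_sin[of "u / 2"] sin_double[of "u / 2"] by (simp_all add: power2_eq_square)
  then show ?thesis
    by (simp add: complex_eq_iff)
qed

lemma prod_cis: "(\<Prod>k\<in>A. cis (f k)) = cis (\<Sum>k\<in>A. f k)"
  by (induction A rule: infinite_finite_induct) (auto simp: cis_mult)

text \<open>Expanded along its last row, the determinant is, up to a power of a unit complex number, a
  polynomial of degree at most \<open>m = n + 1\<close> in \<open>cis (\<plusminus>\<theta> m)\<close> that vanishes at the other \<open>m\<close> nodes, and whose
  constant term is the smaller determinant. Each factor \<open>1 - cis (\<theta> m - \<theta> k)\<close> is a half-angle sine
  times a phase, and all the phases cancel.\<close>

lemma exp_det_Suc:
  assumes inj: "inj_on (\<lambda>k. cis (\<theta> k)) {..n}"
  shows "exp_det (Suc n) \<theta> = (- 2 * \<i> * parity_sign (Suc n)) ^ Suc n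
           * (\<Prod>k<Suc n. of_real (sin ((\<theta> (Suc n) - \<theta> k) / 2))) * exp_det n \<theta>"
proof -
  define m where "m = Suc n"
  define \<sigma> where "\<sigma> = parity_sign m"
  \<comment> \<open>With powers of \<open>cis (\<sigma> * y)\<close>, the new exponent becomes \<open>b m = 0\<close> and all others lie in \<open>{1..m}\<close>.\<close>
  define b where "b c = (if even (m + c) then (m - c) div 2 else (m + c + 1) div 2)" for c
  have \<sigma>: "\<sigma> = 1 \<or> \<sigma> = - 1" by (auto simp: \<sigma>_def parity_sign_def)
  have exponent_b: "exponent m c = \<sigma> * (real (b c) - real m / 2)" if "c \<le> m" for c
  proof -
    have "2 * b c = (if even (m + c) then m - c else m + c + 1)"
      by (auto simp: b_def)
    then have "2 * real (b c) = (if even (m + c) then real m - real c else real m + real c + 1)"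
      using that by (auto simp: of_nat_diff split: if_splits)
    then have "real (b c) - real m / 2 = (if even (m + c) then - (real c / 2) else real (c + 1) / 2)"
      by auto
    then show ?thesis unfolding exponent_def \<sigma>_def by simp
  qed
  have exponent_n: "exponent m c = exponent n c + \<sigma> / 2" for c
    by (auto simp: exponent_def \<sigma>_def m_def parity_sign_def field_simps)
  obtain C where C: "\<And>v. det (mat (Suc m) (Suc m)
        (\<lambda>(r, c). if r = m then v c else cis (exponent m c * \<theta> r))) = (\<Sum>c\<le>m. C c * v c)"
    and Cm: "C m = det (mat m m (\<lambda>(r, c). cis (exponent m c * \<theta> r)))"
    by (rule det_last_row[of m "\<lambda>r c. cis (exponent m c * \<theta> r)"]) (rule that)
  have Cm': "C m = cis (\<Sum>k<m. \<sigma> / 2 * \<theta> k) * exp_det n \<theta>"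
    unfolding Cm exp_det_def m_def[symmetric] prod_cis[symmetric] det_scale_rows[symmetric]
    by (simp add: exponent_n cis_mult algebra_simps)
  have row: "(\<Sum>c\<le>m. C c * cis (exponent m c * y))
      = cis (- \<sigma> * m / 2 * y) * (\<Sum>c\<le>m. C c * cis (\<sigma> * y) ^ b c)" for y
    unfolding sum_distrib_left
    by (intro sum.cong) (auto simp: exponent_b Complex.DeMoivre cis_mult algebra_simps)
  have van: "(\<Sum>c\<le>m. C c * cis (\<sigma> * \<theta> k) ^ b c) = 0" if k: "k < m" for k
  proof -
    have "(\<Sum>c\<le>m. C c * cis (exponent m c * \<theta> k)) = 0"
      unfolding C[symmetric]
      by (rule det_identical_rows[of _ "Suc m" k m]) (use k in auto)
    then show ?thesis unfolding row by simp
  qed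
  have "inj_on (\<lambda>k. cis (\<sigma> * \<theta> k)) {..<m}"
    using \<sigma> inj 
    by (auto simp: inj_on_def m_def less_Suc_eq_le cis_cnj[symmetric] simp del: cis_cnj)
  moreover have "0 < b c \<and> b c \<le> m" if "c < m" for c
    unfolding b_def using that by presburger
  ultimately have "(\<Sum>c\<le>m. C c * cis (\<sigma> * y) ^ b c)
      = C m * (\<Prod>k<m. 1 - cis (\<sigma> * y) / cis (\<sigma> * \<theta> k))" for y
    using van by (intro sum_powers_vanishing_at_nodes) (auto simp: b_def)
  moreover have "1 - cis (\<sigma> * y) / cis (\<sigma> * \<theta> k)
      = (- 2 * \<i> * \<sigma>) * cis (\<sigma> * (y - \<theta> k) / 2) * of_real (sin ((y - \<theta> k) / 2))" for y k
  proof -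
    have "cis (\<sigma> * y) / cis (\<sigma> * \<theta> k) = cis (\<sigma> * (y - \<theta> k))"
      by (simp only: cis_divide right_diff_distrib)
    moreover have "sin (\<sigma> * (y - \<theta> k) / 2) = \<sigma> * sin ((y - \<theta> k) / 2)"
    proof (cases "\<sigma> = 1")
      case False
      then have "\<sigma> * (y - \<theta> k) / 2 = - ((y - \<theta> k) / 2)"
        using \<sigma> by (simp add: minus_divide_left)
      then show ?thesis using False \<sigma> by (simp only: sin_minus) simp
    qed simp
    ultimately show ?thesis by (simp only: one_minus_cis) (simp add: mult_ac)
  qed
  moreover have prod3: "(\<Prod>k<m. K * f k * g k) = K ^ m * (\<Prod>k<m. f k) * (\<Prod>k<m. g k)"
    for K :: complex and f g by (simp add: prod.distrib)
  ultimately have expand: "(\<Sum>c\<le>m. C c * cis (\<sigma> * \<theta> m) ^ b c)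
      = C m * ((- 2 * \<i> * \<sigma>) ^ m * cis (\<Sum>k<m. \<sigma> * (\<theta> m - \<theta> k) / 2)
          * (\<Prod>k<m. of_real (sin ((\<theta> m - \<theta> k) / 2))))"
    by (simp only: prod3 prod_cis)
  have "exp_det m \<theta> = (\<Sum>c\<le>m. C c * cis (exponent m c * \<theta> m))"
    unfolding exp_det_def C[symmetric]
    by (rule arg_cong[where f = det], rule eq_matI) auto
  then have "exp_det m \<theta>
      = (- 2 * \<i> * \<sigma>) ^ m * (\<Prod>k<m. of_real (sin ((\<theta> m - \<theta> k) / 2))) * exp_det n \<theta>
        * (cis (- \<sigma> * m / 2 * \<theta> m) * cis (\<Sum>k<m. \<sigma> * (\<theta> m - \<theta> k) / 2)
           * cis (\<Sum>k<m. \<sigma> / 2 * \<theta> k))"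
    unfolding row expand Cm' by (simp only: mult_ac)
  also have "cis (- \<sigma> * m / 2 * \<theta> m) * cis (\<Sum>k<m. \<sigma> * (\<theta> m - \<theta> k) / 2)
      * cis (\<Sum>k<m. \<sigma> / 2 * \<theta> k) = 1"
  proof -
    have "(\<Sum>k<m. \<sigma> * (\<theta> m - \<theta> k) / 2) + (\<Sum>k<m. \<sigma> / 2 * \<theta> k)
        = (\<Sum>k<m. \<sigma> * (\<theta> m - \<theta> k) / 2 + \<sigma> / 2 * \<theta> k)"
      by (simp only: sum.distrib)
    also have "\<dots> = (\<Sum>k<m. \<sigma> * \<theta> m / 2)"
      by (intro sum.cong) (auto simp: field_simps)
    finally have "(\<Sum>k<m. \<sigma> * (\<theta> m - \<theta> k) / 2) + (\<Sum>k<m. \<sigma> / 2 * \<theta> k)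
        = m * (\<sigma> * \<theta> m / 2)" by simp
    moreover have "- \<sigma> * m / 2 * \<theta> m = - (m * (\<sigma> * \<theta> m / 2))" by simp
    ultimately have "- \<sigma> * m / 2 * \<theta> m + (\<Sum>k<m. \<sigma> * (\<theta> m - \<theta> k) / 2)
        + (\<Sum>k<m. \<sigma> / 2 * \<theta> k) = 0" by linarith
    then show ?thesis by (simp only: cis_mult cis_zero)
  qed
  finally show ?thesis unfolding m_def[symmetric] \<sigma>_def by (simp only: mult_1_right)
qed

section \<open>Collocation determinants of the trigonometric systems\<close>

definition trig_system :: "real \<Rightarrow> nat \<Rightarrow> nat \<Rightarrow> real \<Rightarrow> real" where
  "trig_system h m = (if odd m then trig_half h else trig_int h)"

definition freq :: "real \<Rightarrow> real" where "freq h = ln (1 + h) / h"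

lemma cos_h_eq: "cos_h h y = cos (freq h * y)"
  by (simp add: cos_h_def exp_h_def freq_def Re_exp mult.commute)

lemma sin_h_eq: "sin_h h y = sin (freq h * y)"
  by (cases "h = 0") (simp_all add: sin_h_def exp_h_def freq_def Re_exp Im_exp Re_divide power2_eq_square mult.commute)

lemma trig_system_eq:
  "trig_system h m c y = (if c = 0 \<and> even m then 1
     else if even (m + c) then sin (real c / 2 * (freq h * y))
     else cos (real (c + 1) / 2 * (freq h * y)))"
proof (cases "even c")
  case True
  then obtain k where "c = 2 * k" by (elim evenE)
  then show ?thesis
    by (auto simp: trig_system_def trig_int_def trig_half_def cos_h_eq sin_h_eq algebra_simps add_divide_distrib)
next
  case False
  then obtain k where "c = 2 * k + 1" by (elim oddE)
  then show ?thesis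
    by (auto simp: trig_system_def trig_int_def trig_half_def cos_h_eq sin_h_eq algebra_simps add_divide_distrib)
qed

text \<open>The entry in row \<open>b\<close> and column \<open>c\<close> is the coefficient of the \<open>b\<close>-th exponential in the
  \<open>c\<close>-th function of the trigonometric system. Apart from the constant function, the matrix consists
  of blocks of size two on the diagonal, one for each frequency.\<close>

definition exp_to_trig :: "nat \<Rightarrow> nat \<Rightarrow> nat \<Rightarrow> complex" where
  "exp_to_trig m b c =
     (if c = 0 \<and> even m then (if b = 0 then 1 else 0)
      else if even (m + c) then
        (if Suc b = c then parity_sign m / (2 * \<i>) else if b = c then - (parity_sign m / (2 * \<i>)) else 0)
      else if b = c \<or> b = Suc c then 1 / 2 else 0)"

lemma det_exp_to_trig:
  "even (m + n) \<Longrightarrow> det (mat (Suc n) (Suc n) (\<lambda>(b, c). exp_to_trig m b c))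
     = (parity_sign m * \<i> / 2) ^ (Suc n div 2)"
proof (induction n rule: nat_induct2)
  case 0
  then show ?case by (subst det_single) (auto simp: exp_to_trig_def)
next
  case 1
  then show ?case
    unfolding One_nat_def by (subst det_mat_block) (auto simp: exp_to_trig_def)
next
  case (step n)
  have "det (mat (Suc (n + 2)) (Suc (n + 2)) (\<lambda>(b, c). exp_to_trig m b c))
      = det (mat (Suc n) (Suc n) (\<lambda>(b, c). exp_to_trig m b c)) * (parity_sign m * \<i> / 2)"
    unfolding add_2_eq_Suc' using step.prems
    by (subst det_mat_block) (auto simp: exp_to_trig_def le_less_Suc_eq)
  then show ?case using step by simp
qed

lemma sum_exp_to_trig:
  assumes "c \<le> m"
  shows "(\<Sum>b\<le>m. cis (exponent m b * (freq h * y)) * exp_to_trig m b c) = of_real (trig_system h m c y)"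
proof -
  let ?\<theta> = "freq h * y" and ?\<sigma> = "parity_sign m"
  have \<sigma>: "?\<sigma> = 1 \<or> ?\<sigma> = - 1" by (simp add: parity_sign_def)
  show ?thesis
  proof (cases "c = 0 \<and> even m")
    case True
    have "(\<Sum>b\<le>m. cis (exponent m b * ?\<theta>) * exp_to_trig m b c)
        = (\<Sum>b\<in>{0}. cis (exponent m b * ?\<theta>) * exp_to_trig m b c)"
      by (rule sum.mono_neutral_right) (use True in \<open>auto simp: exp_to_trig_def\<close>)
    then show ?thesis using True by (simp add: exp_to_trig_def exponent_def trig_system_eq)
  next
    case not_const: False
    show ?thesis
    proof (cases "even (m + c)")
      case True
      with not_const obtain d where d: "c = Suc d" by (cases c) auto
      have "(\<Sum>b\<le>m. cis (exponent m b * ?\<theta>) * exp_to_trig m b c)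
          = (\<Sum>b\<in>{d, c}. cis (exponent m b * ?\<theta>) * exp_to_trig m b c)"
        by (rule sum.mono_neutral_right) (use True d assms in \<open>auto simp: exp_to_trig_def\<close>)
      also have "\<dots> = (cis (?\<sigma> * (c / 2 * ?\<theta>)) - cis (- (?\<sigma> * (c / 2 * ?\<theta>)))) * (?\<sigma> / (2 * \<i>))"
        using True d not_const by (simp add: exp_to_trig_def exponent_def algebra_simps)
      also have "\<dots> = of_real (sin (c / 2 * ?\<theta>))"
        using \<sigma> by (auto simp: complex_eq_iff)
      finally show ?thesis using True not_const by (simp add: trig_system_eq)
    next
      case False
      with assms have "c < m" by (cases "c = m") auto
      have "(\<Sum>b\<le>m. cis (exponent m b * ?\<theta>) * exp_to_trig m b c)
          = (\<Sum>b\<in>{c, Suc c}. cis (exponent m b * ?\<theta>) * exp_to_trig m b c)"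
        by (rule sum.mono_neutral_right)
          (use False \<open>c < m\<close> not_const in \<open>auto simp: exp_to_trig_def\<close>)
      also have "\<dots> = (cis (?\<sigma> * (real (c + 1) / 2 * ?\<theta>)) + cis (- (?\<sigma> * (real (c + 1) / 2 * ?\<theta>)))) / 2"
        unfolding exp_to_trig_def exponent_def if_not_P[OF not_const]
        using False by (simp add: algebra_simps)
      also have "\<dots> = of_real (cos (real (c + 1) / 2 * ?\<theta>))"
        using \<sigma> by (auto simp: complex_eq_iff)
      finally show ?thesis using False not_const by (auto simp: trig_system_eq)
    qed
  qed
qed

lemma colloc_det_trig_system_exp:
  "complex_of_real (colloc_det (trig_system h m) m x)
     = exp_det m (\<lambda>k. freq h * x k) * (parity_sign m * \<i> / 2) ^ (Suc m div 2)"
proof -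
  let ?E = "mat (Suc m) (Suc m) (\<lambda>(r, c). cis (exponent m c * (freq h * x r)))"
  let ?M = "mat (Suc m) (Suc m) (\<lambda>(b, c). exp_to_trig m b c)"
  have "complex_of_real (colloc_det (trig_system h m) m x)
      = det (map_mat of_real (mat (Suc m) (Suc m) (\<lambda>(r, c). trig_system h m c (x r))))"
    by (simp add: colloc_det_def of_real_hom.hom_det)
  also have "map_mat of_real (mat (Suc m) (Suc m) (\<lambda>(r, c). trig_system h m c (x r))) = ?E * ?M"
  proof (rule eq_matI)
    fix r c assume "r < dim_row (?E * ?M)" "c < dim_col (?E * ?M)"
    then have rc: "r \<le> m" "c \<le> m" by auto
    then have "(?E * ?M) $$ (r, c)
        = (\<Sum>b\<le>m. cis (exponent m b * (freq h * x r)) * exp_to_trig m b c)"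
      by (simp add: scalar_prod_def atLeast0LessThan lessThan_Suc_atMost)
    then show "map_mat of_real (mat (Suc m) (Suc m) (\<lambda>(r, c). trig_system h m c (x r))) $$ (r, c)
        = (?E * ?M) $$ (r, c)"
      using rc by (simp add: sum_exp_to_trig)
  qed auto
  also have "det (?E * ?M) = det ?E * det ?M" by (rule det_mult) auto
  finally show ?thesis by (simp add: exp_det_def det_exp_to_trig)
qed

definition half_sin :: "real \<Rightarrow> real \<Rightarrow> real \<Rightarrow> real" where
  "half_sin h a b = sin_h h ((a - b) / 2)"

text \<open>The form of distinctness that the determinants need: the exponentials of the nodes are
  pairwise distinct. It survives the omission of nodes without any mention of their order.\<close>

definition separated :: "real \<Rightarrow> nat \<Rightarrow> (nat \<Rightarrow> real) \<Rightarrow> bool" where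
  "separated h n x \<longleftrightarrow> (\<forall>i\<le>n. \<forall>k\<le>n. i \<noteq> k \<longrightarrow> half_sin h (x i) (x k) \<noteq> 0)"

lemma half_sin_eq: "half_sin h a b = sin ((freq h * a - freq h * b) / 2)"
  by (simp add: half_sin_def sin_h_eq right_diff_distrib)

lemma half_sin_swap: "half_sin h a b = - half_sin h b a"
proof -
  have "(freq h * a - freq h * b) / 2 = - ((freq h * b - freq h * a) / 2)"
    by (simp add: field_simps)
  then show ?thesis by (simp only: half_sin_eq sin_minus)
qed

text \<open>These powers of two, which also stand in front of the divided difference, are the factors that
  a collocation determinant gains with each further node.\<close>

definition dd_scale :: "nat \<Rightarrow> real" where "dd_scale m = (if odd m then 2 ^ (m - 1) else 2 ^ m)"

lemma dd_scale_nonzero: "dd_scale m \<noteq> 0" by (simp add: dd_scale_def)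

text \<open>The left-hand side collects the determinant of the block matrix and the constants of
  \<open>exp_det_Suc\<close>.\<close>

lemma dd_scale_constants:
  "(parity_sign (Suc n) * \<i> / 2) ^ (Suc (Suc n) div 2) * (- 2 * \<i> * parity_sign (Suc n)) ^ Suc n
     = dd_scale (Suc n) * (parity_sign n * \<i> / 2) ^ (Suc n div 2)"
proof (cases "even n")
  case True
  then obtain k where k: "n = 2 * k" by (elim evenE)
  have "x ^ Suc k * z ^ Suc (2 * k) = (x * z) * (x * z ^ 2) ^ k" for x z :: complex
    by (simp only: power_Suc power_mult_distrib power_mult[symmetric] mult_ac)
  from this[of "- (\<i> / 2)" "2 * \<i>"] have "(- (\<i> / 2)) ^ Suc k * (2 * \<i>) ^ Suc (2 * k) = (4 * (\<i> / 2)) ^ k"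
    by (simp add: power2_eq_square)
  also have "\<dots> = 2 ^ (2 * k) * (\<i> / 2) ^ k" by (simp only: power_mult power_mult_distrib) simp
  finally show ?thesis
    by (simp add: k parity_sign_def dd_scale_def del: power_Suc)
next
  case False
  then obtain k where k: "n = 2 * k + 1" by (elim oddE)
  have "x ^ Suc k * z ^ (2 * Suc k) = (x * z ^ 2) ^ Suc k" for x z :: complex
    by (simp only: power_mult_distrib power_mult[symmetric] mult_ac)
  from this[of "\<i> / 2" "- 2 * \<i>"]
  have "(\<i> / 2) ^ Suc k * (- 2 * \<i>) ^ (2 * Suc k) = (4 * (- \<i> / 2)) ^ Suc k"
    by (simp add: power2_eq_square)
  also have "\<dots> = 2 ^ (2 * Suc k) * (- \<i> / 2) ^ Suc k"
    by (simp only: power_mult power_mult_distrib) simp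
  finally show ?thesis
    by (simp add: k parity_sign_def dd_scale_def del: power_Suc)
qed

text \<open>Transfers \<open>exp_det_Suc\<close> from the exponentials to cosine and sine. The determinant on the
  left belongs to the half-integer system if the one on the right belongs to the integer system, and
  conversely.\<close>

lemma colloc_det_trig_system_Suc:
  assumes "separated h n x"
  shows "colloc_det (trig_system h (Suc n)) (Suc n) x
           = dd_scale (Suc n) * (\<Prod>k<Suc n. half_sin h (x (Suc n)) (x k)) * colloc_det (trig_system h n) n x"
proof -
  have inj: "inj_on (\<lambda>k. cis (freq h * x k)) {..n}"
  proof (rule inj_onI)
    fix i k assume ik: "i \<in> {..n}" "k \<in> {..n}" "cis (freq h * x i) = cis (freq h * x k)"
    then have "1 - cis (freq h * x i - freq h * x k) = 0"
      by (simp flip: cis_divide)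
    then have "half_sin h (x i) (x k) = 0"
      by (simp add: one_minus_cis half_sin_eq)
    then show "i = k" using assms ik by (auto simp: separated_def)
  qed
  let ?P = "\<Prod>k<Suc n. complex_of_real (half_sin h (x (Suc n)) (x k))"
  have "complex_of_real (colloc_det (trig_system h (Suc n)) (Suc n) x)
     = ((parity_sign (Suc n) * \<i> / 2) ^ (Suc (Suc n) div 2) * (- 2 * \<i> * parity_sign (Suc n)) ^ Suc n)
       * ?P * exp_det n (\<lambda>k. freq h * x k)"
    unfolding colloc_det_trig_system_exp exp_det_Suc[OF inj] half_sin_eq by (simp only: mult_ac)
  also have "\<dots> = complex_of_real (dd_scale (Suc n)) * ?P * complex_of_real (colloc_det (trig_system h n) n x)"
    unfolding dd_scale_constants colloc_det_trig_system_exp by (simp only: mult_ac)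
  finally show ?thesis by (simp only: of_real_prod[symmetric] of_real_mult[symmetric] of_real_eq_iff)
qed

text \<open>The trigonometric analogue of the Vandermonde product.\<close>

definition diff_prod :: "real \<Rightarrow> nat \<Rightarrow> (nat \<Rightarrow> real) \<Rightarrow> real" where
  "diff_prod h n x = (\<Prod>k\<le>n. \<Prod>i<k. half_sin h (x k) (x i))"

lemma separated_mono: "separated h n x \<Longrightarrow> k \<le> n \<Longrightarrow> separated h k x"
  by (auto simp: separated_def)

lemma diff_prod_nonzero: "separated h n x \<Longrightarrow> diff_prod h n x \<noteq> 0"
  by (auto simp: diff_prod_def separated_def)

lemma colloc_det_trig_system:
  "separated h n x \<Longrightarrow> colloc_det (trig_system h n) n x = (\<Prod>k<n. dd_scale (Suc k)) * diff_prod h n x"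
proof (induction n)
  case 0
  show ?case
    by (simp add: colloc_det_def det_single trig_system_def trig_int_def diff_prod_def)
next
  case (Suc n)
  then have "separated h n x" using separated_mono by simp
  with Suc show ?case by (simp add: colloc_det_trig_system_Suc diff_prod_def)
qed

section \<open>The divided difference as a weighted sum\<close>

definition skip :: "nat \<Rightarrow> nat \<Rightarrow> nat" where "skip i k = (if k < i then k else Suc k)"

lemma skip_image:
  assumes "i \<le> n"
  shows "skip i ` {..<n} = {..<Suc n} - {i}"
proof (intro equalityI subsetI)
  fix k assume "k \<in> {..<Suc n} - {i}"
  with assms have "k = skip i (if k < i then k else k - 1)" "(if k < i then k else k - 1) < n"
    by (auto simp: skip_def)
  then show "k \<in> skip i ` {..<n}" by blast
qed (use assms in \<open>auto simp: skip_def\<close>)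

lemma inj_skip: "inj_on (skip i) A"
  by (auto simp: inj_on_def skip_def split: if_splits)

lemma separated_skip: "separated h (Suc n) x \<Longrightarrow> separated h n (\<lambda>k. x (skip i k))"
  by (auto simp: separated_def skip_def)

text \<open>The factors that contain \<open>x i\<close> are the only ones lost when this node is omitted; the sign
  counts those in which \<open>x i\<close> stands second.\<close>

lemma diff_prod_skip:
  "i \<le> Suc n \<Longrightarrow> (- 1) ^ (i + Suc n) * diff_prod h (Suc n) x
     = diff_prod h n (\<lambda>k. x (skip i k)) * (\<Prod>k\<in>{..Suc n} - {i}. half_sin h (x i) (x k))"
proof (induction n)
  case 0
  then consider "i = 0" | "i = 1" by linarith
  then show ?case
  proof cases
    case 1
    have "{..Suc 0} - {0} = {Suc 0}" by auto
    then show ?thesis using 1 half_sin_swap[of h "x 0" "x 1"] by (simp add: diff_prod_def)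
  next
    case 2
    have "{..Suc 0} - {Suc 0} = {0}" by auto
    then show ?thesis using 2 by (simp add: diff_prod_def)
  qed
next
  case (Suc n)
  let ?N = "Suc (Suc n)"
  show ?case
  proof (cases "i = ?N")
    case True
    have "diff_prod h (Suc n) (\<lambda>k. x (skip i k)) = diff_prod h (Suc n) x"
      unfolding diff_prod_def by (intro prod.cong) (auto simp: skip_def True)
    moreover have "{..?N} - {?N} = {..<?N}" by auto
    ultimately show ?thesis using True by (simp add: diff_prod_def)
  next
    case False
    then have i: "i \<le> Suc n" using Suc.prems by simp
    let ?s = "half_sin h"
    have top: "(\<Prod>k<?N. ?s (x ?N) (x k)) = ?s (x ?N) (x i) * (\<Prod>k<Suc n. ?s (x ?N) (x (skip i k)))"
    proof -
      have "(\<Prod>k<?N. ?s (x ?N) (x k)) = ?s (x ?N) (x i) * (\<Prod>k\<in>{..<?N} - {i}. ?s (x ?N) (x k))"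
        by (rule prod.remove) (use i in auto)
      also have "{..<?N} - {i} = skip i ` {..<Suc n}" using skip_image i by simp
      finally show ?thesis by (simp only: prod.reindex[OF inj_skip] o_def)
    qed
    have left: "diff_prod h ?N x = diff_prod h (Suc n) x * (\<Prod>k<?N. ?s (x ?N) (x k))"
      by (simp add: diff_prod_def)
    have right: "diff_prod h (Suc n) (\<lambda>k. x (skip i k))
        = diff_prod h n (\<lambda>k. x (skip i k)) * (\<Prod>k<Suc n. ?s (x ?N) (x (skip i k)))"
      using i by (simp add: diff_prod_def skip_def)
    have "{..?N} - {i} = insert ?N ({..Suc n} - {i})" using i by auto
    then have nodes: "(\<Prod>k\<in>{..?N} - {i}. ?s (x i) (x k))
        = - ?s (x ?N) (x i) * (\<Prod>k\<in>{..Suc n} - {i}. ?s (x i) (x k))"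
      using half_sin_swap[of h "x i" "x ?N"] by simp
    have "(- 1) ^ (i + ?N) * diff_prod h ?N x
        = - ((- 1) ^ (i + Suc n) * diff_prod h (Suc n) x) * (\<Prod>k<?N. ?s (x ?N) (x k))"
      unfolding left by simp
    then show ?thesis
      unfolding Suc.IH[OF i] top right nodes by (simp only: mult_ac mult_minus_left mult_minus_right)
  qed
qed

lemma colloc_det_last_column:
  "colloc_det (\<phi>(Suc n := f)) (Suc n) x
     = (\<Sum>i\<le>Suc n. f (x i) * ((- 1) ^ (i + Suc n) * colloc_det \<phi> n (\<lambda>k. x (skip i k))))"
proof -
  let ?A = "mat (Suc (Suc n)) (Suc (Suc n)) (\<lambda>(r, c). (\<phi>(Suc n := f)) c (x r))"
  have del: "det (mat_delete ?A i (Suc n)) = colloc_det \<phi> n (\<lambda>k. x (skip i k))" if "i \<le> Suc n" for i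
    unfolding colloc_det_def
    by (rule arg_cong[where f = det], rule eq_matI) (use that in \<open>auto simp: mat_delete_def skip_def\<close>)
  have "det ?A = (\<Sum>i<Suc (Suc n). ?A $$ (i, Suc n) * cofactor ?A i (Suc n))"
    by (rule laplace_expansion_column) auto
  also have "\<dots> = (\<Sum>i\<le>Suc n. f (x i) * ((- 1) ^ (i + Suc n) * colloc_det \<phi> n (\<lambda>k. x (skip i k))))"
    by (intro sum.cong) (auto simp: cofactor_def del fun_upd_same simp del: fun_upd_apply power_Suc)
  finally show ?thesis by (simp add: colloc_det_def)
qed

text \<open>The Lagrange form of the divided difference. The minors of the last column of the numerator are
  collocation determinants with one node fewer and of the opposite parity, so that numerator and
  denominator are both given by \<open>colloc_det_trig_system\<close>. All powers of two and all signs cancel,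
  and the two parities of \<open>m\<close> lead to the same formula.\<close>

lemma trig_dd_distinct_eq_sum:
  assumes "separated h m x" and "m > 0"
  shows "trig_dd_distinct h m x f = (\<Sum>i\<le>m. f (x i) / (\<Prod>k\<in>{..m} - {i}. half_sin h (x i) (x k)))"
proof -
  obtain n where m: "m = Suc n" using assms by (cases m) auto
  have sep: "separated h (Suc n) x" using assms m by simp
  let ?K = "\<Prod>k<n. dd_scale (Suc k)"
  have K: "?K \<noteq> 0" using dd_scale_nonzero by simp
  have "trig_dd_distinct h m x f
      = dd_scale m * (colloc_det ((trig_system h n)(m := f)) m x / colloc_det (trig_system h m) m x)"
    by (auto simp: trig_dd_distinct_def dd_scale_def trig_system_def m)
  also have "\<dots> = (\<Sum>i\<le>m. f (x i) * (dd_scale m * ((- 1) ^ (i + m) * colloc_det (trig_system h n) n (\<lambda>k. x (skip i k)))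
      / colloc_det (trig_system h m) m x))"
    unfolding m colloc_det_last_column sum_divide_distrib sum_distrib_left
    by (intro sum.cong) (simp_all only: times_divide_eq_right mult_ac)
  also have "\<dots> = (\<Sum>i\<le>m. f (x i) / (\<Prod>k\<in>{..m} - {i}. half_sin h (x i) (x k)))"
  proof (intro sum.cong refl)
    fix i assume "i \<in> {..m}"
    then have i: "i \<le> Suc n" by (simp add: m)
    let ?Q = "\<Prod>k\<in>{..m} - {i}. half_sin h (x i) (x k)"
    have Q: "?Q \<noteq> 0" using assms i by (auto simp: separated_def m)
    have D: "diff_prod h m x \<noteq> 0" using assms diff_prod_nonzero by simp
    have "(- 1) ^ (i + m) * diff_prod h n (\<lambda>k. x (skip i k)) * ?Q
        = (- 1) ^ (i + m) * ((- 1) ^ (i + m) * diff_prod h m x)"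
      using diff_prod_skip[OF i, of h x] by (simp only: m mult.assoc)
    also have "\<dots> = diff_prod h m x" by (simp flip: mult.assoc power_add)
    finally have "(- 1) ^ (i + m) * diff_prod h n (\<lambda>k. x (skip i k)) / diff_prod h m x = 1 / ?Q"
      using Q D by (simp add: field_simps)
    moreover have "dd_scale m * ((- 1) ^ (i + m) * colloc_det (trig_system h n) n (\<lambda>k. x (skip i k)))
        / colloc_det (trig_system h m) m x
        = (- 1) ^ (i + m) * diff_prod h n (\<lambda>k. x (skip i k)) / diff_prod h m x"
    proof -
      have "s * (e * (k * d)) / (k * s * D) = e * d / D" if "s \<noteq> 0" "k \<noteq> 0" for s e k d D :: real
        using that by simp
      from this[OF dd_scale_nonzero K] show ?thesis
        unfolding m colloc_det_trig_system[OF separated_skip[OF sep]] colloc_det_trig_system[OF sep]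
          prod.lessThan_Suc .
    qed
    ultimately show "f (x i) * (dd_scale m * ((- 1) ^ (i + m) * colloc_det (trig_system h n) n (\<lambda>k. x (skip i k)))
        / colloc_det (trig_system h m) m x) = f (x i) / ?Q"
      by simp
  qed
  finally show ?thesis .
qed

section \<open>The recurrence at distinct nodes\<close>

text \<open>A three-term Pluecker relation for the vectors \<open>(cos, sin)\<close> at the four half-angles; it
  plays the part of the linear interpolation identity
  \<open>(a - u) (y - v) + (v - a) (y - u) = (v - u) (y - a)\<close>.\<close>

lemma half_sin_product_identity:
  "half_sin h a u * half_sin h y v + half_sin h v a * half_sin h y u = half_sin h v u * half_sin h y a"
  by (simp add: half_sin_eq diff_divide_distrib sin_diff algebra_simps)

lemma half_sin_self [simp]: "half_sin h a a = 0"
  by (simp add: half_sin_eq)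

text \<open>In the Lagrange form, passing from the nodes \<open>x 0, \<dots>, x (m + 1)\<close> to the first or the last
  \<open>m + 1\<close> of them multiplies the weight of \<open>x i\<close> by a sine of the distance to the omitted node,
  which also makes the weight of that node zero. Thus all three divided differences
  are sums over the same nodes, and they can be compared term by term.\<close>

lemma trig_dd_distinct_recurrence:
  assumes sep: "separated h (Suc m) x" and "m > 0"
  shows "trig_dd_distinct h (Suc m) x (\<lambda>y. half_sin h y a * g y)
    = half_sin h a (x 0) / half_sin h (x (Suc m)) (x 0) * trig_dd_distinct h m x g
    + half_sin h (x (Suc m)) a / half_sin h (x (Suc m)) (x 0) * trig_dd_distinct h m (\<lambda>k. x (Suc k)) g"
proof -
  let ?s = "half_sin h" and ?n = "Suc m"
  define P where "P i = (\<Prod>k\<in>{..?n} - {i}. ?s (x i) (x k))" for i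
  have nz: "?s (x i) (x k) \<noteq> 0" if "i \<le> ?n" "k \<le> ?n" "i \<noteq> k" for i k
    using sep that by (auto simp: separated_def)
  have "trig_dd_distinct h m x g = (\<Sum>i\<le>m. g (x i) / (\<Prod>k\<in>{..m} - {i}. ?s (x i) (x k)))"
    using assms by (intro trig_dd_distinct_eq_sum separated_mono[OF sep]) auto
  also have "\<dots> = (\<Sum>i\<le>m. g (x i) * ?s (x i) (x ?n) / P i)"
  proof (intro sum.cong refl)
    fix i assume "i \<in> {..m}"
    then have i: "i \<le> m" by simp
    then have "{..?n} - {i} = insert ?n ({..m} - {i})" by auto
    then have "P i = ?s (x i) (x ?n) * (\<Prod>k\<in>{..m} - {i}. ?s (x i) (x k))" by (simp add: P_def)
    then show "g (x i) / (\<Prod>k\<in>{..m} - {i}. ?s (x i) (x k)) = g (x i) * ?s (x i) (x ?n) / P i"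
      using nz[of i ?n] i by simp
  qed
  also have "\<dots> = (\<Sum>i\<le>?n. g (x i) * ?s (x i) (x ?n) / P i)" by simp
  finally have first: "trig_dd_distinct h m x g = (\<Sum>i\<le>?n. g (x i) * ?s (x i) (x ?n) / P i)" .
  have "separated h m (\<lambda>k. x (Suc k))" using sep by (auto simp: separated_def)
  then have "trig_dd_distinct h m (\<lambda>k. x (Suc k)) g
      = (\<Sum>i\<le>m. g (x (Suc i)) / (\<Prod>k\<in>{..m} - {i}. ?s (x (Suc i)) (x (Suc k))))"
    using assms by (intro trig_dd_distinct_eq_sum) auto
  also have "\<dots> = (\<Sum>i\<le>m. g (x (Suc i)) * ?s (x (Suc i)) (x 0) / P (Suc i))"
  proof (intro sum.cong refl)
    fix i assume "i \<in> {..m}"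
    then have i: "i \<le> m" by simp
    have "{..?n} - {Suc i} = insert 0 (Suc ` ({..m} - {i}))"
      by (auto simp: atMost_Suc_eq_insert_0)
    then have "P (Suc i) = ?s (x (Suc i)) (x 0) * (\<Prod>k\<in>{..m} - {i}. ?s (x (Suc i)) (x (Suc k)))"
      by (simp add: P_def prod.reindex)
    then show "g (x (Suc i)) / (\<Prod>k\<in>{..m} - {i}. ?s (x (Suc i)) (x (Suc k)))
        = g (x (Suc i)) * ?s (x (Suc i)) (x 0) / P (Suc i)"
      using nz[of "Suc i" 0] i by simp
  qed
  also have "\<dots> = (\<Sum>i\<le>?n. g (x i) * ?s (x i) (x 0) / P i)"
    by (subst sum.atMost_Suc_shift) simp
  finally have second: "trig_dd_distinct h m (\<lambda>k. x (Suc k)) g = (\<Sum>i\<le>?n. g (x i) * ?s (x i) (x 0) / P i)" .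
  have "trig_dd_distinct h ?n x (\<lambda>y. ?s y a * g y) = (\<Sum>i\<le>?n. ?s (x i) a * g (x i) / P i)"
    unfolding P_def by (rule trig_dd_distinct_eq_sum[OF sep]) simp
  also have "\<dots> = (\<Sum>i\<le>?n. ?s a (x 0) / ?s (x ?n) (x 0) * (g (x i) * ?s (x i) (x ?n) / P i)
      + ?s (x ?n) a / ?s (x ?n) (x 0) * (g (x i) * ?s (x i) (x 0) / P i))"
  proof (intro sum.cong refl)
    fix i
    have "?s (x i) a = (?s a (x 0) * ?s (x i) (x ?n) + ?s (x ?n) a * ?s (x i) (x 0)) / ?s (x ?n) (x 0)"
      unfolding half_sin_product_identity using nz[of ?n 0] by simp
    then show "?s (x i) a * g (x i) / P i = ?s a (x 0) / ?s (x ?n) (x 0) * (g (x i) * ?s (x i) (x ?n) / P i)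
      + ?s (x ?n) a / ?s (x ?n) (x 0) * (g (x i) * ?s (x i) (x 0) / P i)"
      by (simp add: add_divide_distrib algebra_simps)
  qed
  also have "\<dots> = ?s a (x 0) / ?s (x ?n) (x 0) * trig_dd_distinct h m x g
      + ?s (x ?n) a / ?s (x ?n) (x 0) * trig_dd_distinct h m (\<lambda>k. x (Suc k)) g"
    unfolding first second sum.distrib sum_distrib_left ..
  finally show ?thesis .
qed

lemma trig_dd_distinct_cong:
  assumes "separated h m x" "m > 0" and "\<And>i. i \<le> m \<Longrightarrow> f (x i) = g (x i)"
  shows "trig_dd_distinct h m x f = trig_dd_distinct h m x g"
  using assms by (simp add: trig_dd_distinct_eq_sum)

text \<open>A product of \<open>n\<close> half-angle sines lies in the span of the first \<open>n + 1\<close> columns of the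
  numerator. The recurrence gives the same conclusion, without an expansion of the product, by
  splitting off one factor at a time.\<close>

lemma trig_dd_distinct_product_eq_0:
  "separated h (Suc n) x \<Longrightarrow> trig_dd_distinct h (Suc n) x (\<lambda>y. \<Prod>l<n. half_sin h y (a l)) = 0"
proof (induction n arbitrary: x)
  case 0
  have "{..Suc 0} - {0} = {Suc 0}" "{..Suc 0} - {Suc 0} = {0}" by auto
  then show ?case using 0 half_sin_swap[of h "x 0" "x (Suc 0)"]
    by (subst trig_dd_distinct_eq_sum) auto
next
  case (Suc n)
  have "separated h (Suc n) x" using separated_mono[OF Suc.prems] by simp
  moreover have "separated h (Suc n) (\<lambda>k. x (Suc k))" using Suc.prems by (auto simp: separated_def)
  ultimately show ?case
    using Suc.IH trig_dd_distinct_recurrence[OF Suc.prems, of "a n" "\<lambda>y. \<Prod>l<n. half_sin h y (a l)"]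
    by (simp add: mult.commute)
qed

section \<open>Limits at coalescing nodes\<close>

lemma freq_pos: "h \<noteq> 0 \<Longrightarrow> h > - 1 \<Longrightarrow> freq h > 0"
  by (cases "h > 0") (auto simp: freq_def divide_neg_neg)

lemma half_sin_pos:
  assumes "freq h > 0" and "b < a" "a - b < 2 * pi / freq h"
  shows "half_sin h a b > 0"
proof -
  have "freq h * (a - b) < 2 * pi" using assms by (simp add: field_simps)
  then show ?thesis using assms unfolding half_sin_eq
    by (intro sin_gt_zero) (auto simp: algebra_simps)
qed

lemma separated_strict_mono:
  assumes "freq h > 0" and mono: "strict_mono_on {..m} x" and span: "x m - x 0 < 2 * pi / freq h"
  shows "separated h m x"
proof -
  have "half_sin h (x k) (x i) > 0" if "i < k" "k \<le> m" for i k
  proof (rule half_sin_pos)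
    have "x 0 \<le> x i" "x k \<le> x m"
      using strict_mono_on_leD[OF mono] that by auto
    then show "x k - x i < 2 * pi / freq h" using span by simp
    show "x i < x k" using strict_mono_onD[OF mono] that by auto
  qed (fact assms)
  then have "half_sin h (x i) (x k) \<noteq> 0" if "i \<noteq> k" "i \<le> m" "k \<le> m" for i k
    using that half_sin_swap[of h "x i" "x k"] by (cases i k rule: linorder_cases) fastforce+
  then show ?thesis by (auto simp: separated_def)
qed

lemma left_nodes_component:
  assumes "i \<le> m" shows "filterlim (\<lambda>y. y i) (at_left (x i)) (left_nodes m x)"
proof -
  have "left_nodes m x \<le> filtercomap (\<lambda>y. y i) (at_left (x i))"
    unfolding left_nodes_def using assms by (intro le_infI1 INF_lower) auto
  then show ?thesis by (rule filterlim_mono[OF filterlim_filtercomap order_refl])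
qed

lemma left_nodes_tendsto: "i \<le> m \<Longrightarrow> ((\<lambda>y. y i) \<longlongrightarrow> x i) (left_nodes m x)"
  using left_nodes_component[of i m x] by (simp add: filterlim_at)

lemma eventually_left_nodes_strict_mono: "eventually (\<lambda>y. strict_mono_on {..m} y) (left_nodes m x)"
  unfolding left_nodes_def by (auto intro: filter_leD[OF inf_le2] simp: eventually_principal)

lemma filterlim_left_nodesI:
  assumes "\<And>i. i \<le> m \<Longrightarrow> filterlim (\<lambda>a. g a i) (at_left (x i)) F"
    and "eventually (\<lambda>a. strict_mono_on {..m} (g a)) F"
  shows "filterlim g (left_nodes m x) F"
  unfolding left_nodes_def filterlim_inf filterlim_INF filterlim_principal filterlim_filtercomap_iff
  using assms by (auto simp: o_def)

text \<open>Limits along \<open>left_nodes\<close> are unique because increasing tuples exist arbitrarily close to the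
  given nodes: shift the \<open>i\<close>-th node to the left by a multiple of \<open>e\<close> that decreases with \<open>i\<close>.\<close>

lemma left_nodes_neq_bot:
  assumes "mono_on {..m} x" shows "left_nodes m x \<noteq> bot"
proof -
  define g where "g e i = x i - e * real (Suc m - i)" for e i
  have "filterlim g (left_nodes m x) (at_right 0)"
  proof (rule filterlim_left_nodesI)
    fix i assume i: "i \<le> m"
    have "((\<lambda>e. x i - e * real (Suc m - i)) \<longlongrightarrow> x i - 0 * real (Suc m - i)) (at_right 0)"
      by (intro tendsto_intros)
    moreover have "eventually (\<lambda>e. x i - e * real (Suc m - i) < x i) (at_right 0)"
      using i by (intro eventually_at_right_less[THEN eventually_mono]) auto
    ultimately show "filterlim (\<lambda>e. g e i) (at_left (x i)) (at_right 0)"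
      unfolding g_def by (simp add: filterlim_at) (auto elim: eventually_mono)
  next
    have "strict_mono_on {..m} (g e)" if "e > 0" for e
    proof (rule strict_mono_onI)
      fix i k assume ik: "i \<in> {..m}" "k \<in> {..m}" "i < k"
      then have "x i \<le> x k" using assms by (auto simp: mono_on_def)
      moreover have "e * real (Suc m - k) < e * real (Suc m - i)" using ik that by auto
      ultimately show "g e i < g e k" by (simp add: g_def)
    qed
    then show "eventually (\<lambda>e. strict_mono_on {..m} (g e)) (at_right 0)"
      by (intro eventually_at_right_less[THEN eventually_mono])
  qed
  then have "filtermap g (at_right 0) \<noteq> bot \<Longrightarrow> left_nodes m x \<noteq> bot"
    by (auto simp: filterlim_def bot_unique)
  then show ?thesis by (simp add: filtermap_bot_iff)
qed

lemma left_nodes_initial: "filterlim (\<lambda>y. y) (left_nodes m x) (left_nodes (Suc m) x)"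
proof (rule filterlim_left_nodesI)
  show "eventually (\<lambda>y. strict_mono_on {..m} y) (left_nodes (Suc m) x)"
    using eventually_left_nodes_strict_mono
    by (rule eventually_mono) (auto simp: monotone_on_def)
qed (simp add: left_nodes_component)

lemma left_nodes_final:
  "filterlim (\<lambda>y k. y (Suc k)) (left_nodes m (\<lambda>k. x (Suc k))) (left_nodes (Suc m) x)"
proof (rule filterlim_left_nodesI)
  show "eventually (\<lambda>y. strict_mono_on {..m} (\<lambda>k. y (Suc k))) (left_nodes (Suc m) x)"
    using eventually_left_nodes_strict_mono
    by (rule eventually_mono) (auto simp: monotone_on_def)
qed (simp add: left_nodes_component)

lemma eventually_left_nodes_separated:
  assumes "freq h > 0" and "x m - x 0 < 2 * pi / freq h"
  shows "eventually (\<lambda>y. separated h m y) (left_nodes m x)"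
proof -
  have "((\<lambda>y. y m - y 0) \<longlongrightarrow> x m - x 0) (left_nodes m x)"
    by (intro tendsto_diff left_nodes_tendsto) auto
  then have "eventually (\<lambda>y. y m - y 0 < 2 * pi / freq h) (left_nodes m x)"
    using assms by (intro order_tendstoD)
  with eventually_left_nodes_strict_mono show ?thesis
    by eventually_elim (use assms in \<open>auto intro: separated_strict_mono\<close>)
qed

text \<open>Raising the order adds to the truncated power one factor that is free of the truncation, which
  is what the recurrence for divided differences asks for.\<close>

lemma trunc_sin_h_Suc:
  "trunc_sin_h h (Suc p) t y = half_sin h y (t - real p * h) * trunc_sin_h h p t y"
  by (simp add: trunc_sin_h_def half_sin_def)

lemma tendsto_half_sin:
  assumes "(f \<longlongrightarrow> a) F" "(g \<longlongrightarrow> b) F"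
  shows "((\<lambda>y. half_sin h (f y) (g y)) \<longlongrightarrow> half_sin h a b) F"
  unfolding half_sin_eq
  by (intro isCont_tendsto_compose[where g = sin] isCont_sin tendsto_divide tendsto_diff tendsto_mult
      tendsto_const assms) simp

text \<open>The jump at \<open>t\<close> does not matter from the left, as the truncated power vanishes on
  \<open>y \<le> t\<close>. This is the reason for approaching the nodes from the left.\<close>

lemma trunc_sin_h_left_continuous: "(trunc_sin_h h p t \<longlongrightarrow> trunc_sin_h h p t z) (at_left z)"
proof (cases "z \<le> t")
  case True
  have "eventually (\<lambda>y. trunc_sin_h h p t z = trunc_sin_h h p t y) (at_left z)"
    using eventually_at_left_real[of "z - 1" z] True
    by (auto elim!: eventually_mono simp: trunc_sin_h_def)
  then show ?thesis by (rule tendsto_eventually[OF eventually_mono]) simp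
next
  case False
  have "((\<lambda>y. \<Prod>l<p. half_sin h y (t - real l * h)) \<longlongrightarrow> (\<Prod>l<p. half_sin h z (t - real l * h))) (at_left z)"
    by (intro tendsto_prod tendsto_half_sin tendsto_intros)
  moreover have "eventually (\<lambda>y. (\<Prod>l<p. half_sin h y (t - real l * h)) = trunc_sin_h h p t y) (at_left z)"
    using eventually_at_left_real[of t z] False
    by (auto elim!: eventually_mono simp: trunc_sin_h_def half_sin_def)
  moreover have "trunc_sin_h h p t z = (\<Prod>l<p. half_sin h z (t - real l * h))"
    using False by (simp add: trunc_sin_h_def half_sin_def)
  ultimately show ?thesis by (simp only: Lim_transform_eventually)
qed

lemma tendsto_trig_dd_distinct_at_distinct_nodes:
  assumes "freq h > 0" and "m > 0" and mono: "strict_mono_on {..m} x" and span: "x m - x 0 < 2 * pi / freq h"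
    and f: "\<And>i. i \<le> m \<Longrightarrow> (f \<longlongrightarrow> f (x i)) (at_left (x i))"
  shows "((\<lambda>y. trig_dd_distinct h m y f) \<longlongrightarrow> trig_dd_distinct h m x f) (left_nodes m x)"
proof -
  have sep: "separated h m x" by (rule separated_strict_mono) fact+
  let ?D = "\<lambda>y. \<Sum>i\<le>m. f (y i) / (\<Prod>k\<in>{..m} - {i}. half_sin h (y i) (y k))"
  have "((\<lambda>y. f (y i)) \<longlongrightarrow> f (x i)) (left_nodes m x)" if "i \<le> m" for i
    by (rule filterlim_compose[OF f left_nodes_component]) (use that in auto)
  then have "(?D \<longlongrightarrow> ?D x) (left_nodes m x)"
    using sep by (intro tendsto_sum tendsto_divide tendsto_prod tendsto_half_sin left_nodes_tendsto)
      (auto simp: separated_def)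
  moreover have "eventually (\<lambda>y. ?D y = trig_dd_distinct h m y f) (left_nodes m x)"
    using eventually_left_nodes_separated[OF assms(1) span]
    by (rule eventually_mono) (use \<open>m > 0\<close> in \<open>simp add: trig_dd_distinct_eq_sum\<close>)
  moreover have "trig_dd_distinct h m x f = ?D x"
    using sep \<open>m > 0\<close> by (simp add: trig_dd_distinct_eq_sum)
  ultimately show ?thesis by (simp only: Lim_transform_eventually)
qed

text \<open>To the left of and close to the common node, the truncated power is either zero or the full
  product, and the divided difference annihilates both. This matches the convention that a B-spline
  with coinciding end knots is zero.\<close>

lemma tendsto_trig_dd_distinct_at_equal_nodes:
  assumes "freq h > 0" and mono: "mono_on {..Suc n} x" and eq: "x (Suc n) = x 0"
  shows "((\<lambda>y. trig_dd_distinct h (Suc n) y (trunc_sin_h h n t)) \<longlongrightarrow> 0) (left_nodes (Suc n) x)"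
proof -
  let ?m = "Suc n"
  have x: "x i = x 0" if "i \<le> ?m" for i
  proof -
    have "x 0 \<le> x i" "x i \<le> x ?m" using mono that by (auto simp: mono_on_def)
    then show ?thesis using eq by simp
  qed
  have sep: "eventually (\<lambda>y. separated h ?m y) (left_nodes ?m x)"
    using assms by (intro eventually_left_nodes_separated) auto
  define g where "g y = (if x 0 \<le> t then 0 else \<Prod>l<n. half_sin h y (t - real l * h))" for y
  have "eventually (\<lambda>y. trunc_sin_h h n t y = g y) (at_left (x 0))"
  proof (cases "x 0 \<le> t")
    case True
    then show ?thesis using eventually_at_left_real[of "x 0 - 1" "x 0"]
      by (auto elim!: eventually_mono simp: g_def trunc_sin_h_def)
  next
    case False
    then show ?thesis using eventually_at_left_real[of t "x 0"]
      by (auto elim!: eventually_mono simp: g_def trunc_sin_h_def half_sin_def)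
  qed
  then have "eventually (\<lambda>y. trunc_sin_h h n t (y i) = g (y i)) (left_nodes ?m x)" if "i \<le> ?m" for i
    using left_nodes_component[OF that, of x] unfolding x[OF that] filterlim_iff by auto
  then have "eventually (\<lambda>y. \<forall>i\<in>{..?m}. trunc_sin_h h n t (y i) = g (y i)) (left_nodes ?m x)"
    by (intro eventually_ball_finite) auto
  with sep have "eventually (\<lambda>y. trig_dd_distinct h ?m y (trunc_sin_h h n t) = 0) (left_nodes ?m x)"
  proof eventually_elim
    case (elim y)
    then have "trig_dd_distinct h ?m y (trunc_sin_h h n t) = trig_dd_distinct h ?m y g"
      by (intro trig_dd_distinct_cong) auto
    also have "\<dots> = 0"
      using trig_dd_distinct_product_eq_0[OF elim(1)] elim(1)
      by (cases "x 0 \<le> t") (auto simp: g_def[abs_def] trig_dd_distinct_eq_sum)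
    finally show ?case .
  qed
  then show ?thesis by (rule tendsto_eventually)
qed

text \<open>If the divided differences of lower order converge, the recurrence at nearby distinct nodes
  carries convergence over to the next order. Its coefficients are continuous because only
  the end nodes \<open>x 0 < x (n + 2)\<close> enter their denominators; the inner nodes may coincide.\<close>

lemma tendsto_trig_dd_recurrence:
  assumes "freq h > 0" and span: "x (Suc (Suc n)) - x 0 < 2 * pi / freq h" and "x 0 < x (Suc (Suc n))"
    and A: "((\<lambda>y. trig_dd_distinct h (Suc n) y (trunc_sin_h h n t)) \<longlongrightarrow> A) (left_nodes (Suc n) x)"
    and B: "((\<lambda>y. trig_dd_distinct h (Suc n) y (trunc_sin_h h n t)) \<longlongrightarrow> B) (left_nodes (Suc n) (\<lambda>k. x (Suc k)))"
  shows "((\<lambda>y. trig_dd_distinct h (Suc (Suc n)) y (trunc_sin_h h (Suc n) t)) \<longlongrightarrow>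
      half_sin h (t - real n * h) (x 0) / half_sin h (x (Suc (Suc n))) (x 0) * A
      + half_sin h (x (Suc (Suc n))) (t - real n * h) / half_sin h (x (Suc (Suc n))) (x 0) * B)
    (left_nodes (Suc (Suc n)) x)"
proof -
  let ?m = "Suc n" and ?a = "t - real n * h" and ?f = "trunc_sin_h h n t" and ?F = "left_nodes (Suc (Suc n)) x"
  let ?R = "\<lambda>y. half_sin h ?a (y 0) / half_sin h (y (Suc ?m)) (y 0) * trig_dd_distinct h ?m y ?f
      + half_sin h (y (Suc ?m)) ?a / half_sin h (y (Suc ?m)) (y 0) * trig_dd_distinct h ?m (\<lambda>k. y (Suc k)) ?f"
  have "half_sin h (x (Suc ?m)) (x 0) \<noteq> 0"
    using half_sin_pos[OF assms(1,3) span] by simp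
  then have "(?R \<longlongrightarrow> half_sin h ?a (x 0) / half_sin h (x (Suc ?m)) (x 0) * A
      + half_sin h (x (Suc ?m)) ?a / half_sin h (x (Suc ?m)) (x 0) * B) ?F"
    by (intro tendsto_add tendsto_mult tendsto_divide tendsto_half_sin tendsto_const left_nodes_tendsto
        filterlim_compose[OF A left_nodes_initial] filterlim_compose[OF B left_nodes_final]) auto
  moreover have "eventually (\<lambda>y. ?R y = trig_dd_distinct h (Suc ?m) y (trunc_sin_h h ?m t)) ?F"
    using eventually_left_nodes_separated[OF assms(1) span]
  proof eventually_elim
    case (elim y)
    show ?case
      using trig_dd_distinct_recurrence[OF elim, of ?a ?f]
      by (simp add: trunc_sin_h_Suc[abs_def])
  qed
  ultimately show ?thesis by (rule Lim_transform_eventually)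
qed

text \<open>Induction on the order by means of the recurrence replaces a theory of divided differences
  with derivatives at multiple nodes.\<close>

lemma trig_dd_distinct_convergent:
  assumes "freq h > 0"
  shows "mono_on {..Suc n} x \<Longrightarrow> x (Suc n) - x 0 < 2 * pi / freq h
    \<Longrightarrow> \<exists>L. ((\<lambda>y. trig_dd_distinct h (Suc n) y (trunc_sin_h h n t)) \<longlongrightarrow> L) (left_nodes (Suc n) x)"
proof (induction n arbitrary: x)
  case 0
  show ?case
  proof (cases "x (Suc 0) = x 0")
    case True
    then show ?thesis using tendsto_trig_dd_distinct_at_equal_nodes[OF assms 0(1)] by blast
  next
    case False
    then have "x 0 < x (Suc 0)" using 0 by (auto simp: mono_on_def less_le)
    then have "strict_mono_on {..Suc 0} x" by (auto simp: monotone_on_def le_Suc_eq)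
    then show ?thesis
      using tendsto_trig_dd_distinct_at_distinct_nodes[OF assms _ _ 0(2) trunc_sin_h_left_continuous] by blast
  qed
next
  case (Suc n)
  show ?case
  proof (cases "x (Suc (Suc n)) = x 0")
    case True
    then show ?thesis using tendsto_trig_dd_distinct_at_equal_nodes[OF assms Suc.prems(1)] by blast
  next
    case False
    have le: "x i \<le> x k" if "i \<le> k" "k \<le> Suc (Suc n)" for i k
      using Suc.prems(1) that by (auto simp: mono_on_def)
    have "mono_on {..Suc n} x" "mono_on {..Suc n} (\<lambda>k. x (Suc k))"
      by (auto intro!: mono_onI le)
    note mono = this
    obtain A where A: "((\<lambda>y. trig_dd_distinct h (Suc n) y (trunc_sin_h h n t)) \<longlongrightarrow> A) (left_nodes (Suc n) x)"
      using Suc.IH[of x] le[of "Suc n" "Suc (Suc n)"] Suc.prems mono by auto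
    obtain B where B: "((\<lambda>y. trig_dd_distinct h (Suc n) y (trunc_sin_h h n t)) \<longlongrightarrow> B)
        (left_nodes (Suc n) (\<lambda>k. x (Suc k)))"
      using Suc.IH[of "\<lambda>k. x (Suc k)"] le[of 0 "Suc 0"] Suc.prems mono by auto
    have "x 0 < x (Suc (Suc n))" using False le[of 0 "Suc (Suc n)"] by simp
    from tendsto_trig_dd_recurrence[OF assms Suc.prems(2) this A B] show ?thesis by blast
  qed
qed

text \<open>The three readings of a B-spline (zero, value at distinct nodes, limit at partly coinciding
  nodes) are all limits of the same expression along \<open>left_nodes\<close>.\<close>

lemma tendsto_trig_dd:
  assumes "freq h > 0" and mono: "mono_on {..Suc n} x" and span: "x (Suc n) - x 0 < 2 * pi / freq h"
  shows "((\<lambda>y. trig_dd_distinct h (Suc n) y (trunc_sin_h h n t)) \<longlongrightarrow>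
      (if x (Suc n) = x 0 then 0 else trig_dd h (Suc n) x (trunc_sin_h h n t))) (left_nodes (Suc n) x)"
proof -
  consider "x (Suc n) = x 0" | "x (Suc n) \<noteq> x 0" "strict_mono_on {..Suc n} x"
    | "x (Suc n) \<noteq> x 0" "\<not> strict_mono_on {..Suc n} x" by blast
  then show ?thesis
  proof cases
    case 1
    then show ?thesis using tendsto_trig_dd_distinct_at_equal_nodes[OF assms(1) mono] by simp
  next
    case 2
    then show ?thesis
      using tendsto_trig_dd_distinct_at_distinct_nodes[OF assms(1) _ 2(2) span trunc_sin_h_left_continuous]
      by (simp add: trig_dd_def)
  next
    case 3
    obtain L where L: "((\<lambda>y. trig_dd_distinct h (Suc n) y (trunc_sin_h h n t)) \<longlongrightarrow> L) (left_nodes (Suc n) x)"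
      using trig_dd_distinct_convergent[OF assms] by blast
    then show ?thesis
      using 3 tendsto_Lim[OF left_nodes_neq_bot[OF mono] L] by (simp add: trig_dd_def)
  qed
qed

section \<open>The recurrence for B-splines\<close>

theorem theorem5p5:
  fixes h t :: real and m :: nat and x :: "int \<Rightarrow> real" and j :: int
  assumes "h \<noteq> 0" and "h > -1"
    and "m \<ge> 2"
    and "mono x"
    and "0 < x (j + int m) - x j"
    and "x (j + int m) - x j < 2 * pi * h / ln (1 + h)"
  shows "trig_bspline h x j m t =
           sin_h h ((t - (real m - 2) * h - x j) / 2) / sin_h h ((x (j + int m) - x j) / 2)
             * trig_bspline h x j (m - 1) t
         + sin_h h ((x (j + int m) - t + (real m - 2) * h) / 2) / sin_h h ((x (j + int m) - x j) / 2)
             * trig_bspline h x (j + 1) (m - 1) t"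
proof -
  obtain n where m: "m = Suc (Suc n)"
    using \<open>m \<ge> 2\<close> that[of "m - 2"] by simp
  define X where "X i = x (j + int i)" for i
  have freq: "freq h > 0" using assms freq_pos by simp
  have X_mono: "X i \<le> X k" if "i \<le> k" for i k
    using \<open>mono x\<close> that by (simp add: X_def monoD)
  have spline: "trig_bspline h x (j + int s) (Suc p) t
      = (if X (s + Suc p) = X s then 0 else trig_dd h (Suc p) (\<lambda>i. X (s + i)) (trunc_sin_h h p t))" for s p
    by (simp only: trig_bspline_def X_def of_nat_add add.assoc diff_Suc_1)
  have span: "X m - X 0 < 2 * pi / freq h"
    using assms by (simp add: X_def freq_def)
  have lim: "((\<lambda>y. trig_dd_distinct h (Suc p) y (trunc_sin_h h p t)) \<longlongrightarrow> trig_bspline h x (j + int s) (Suc p) t)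
      (left_nodes (Suc p) (\<lambda>i. X (s + i)))" if "s + Suc p \<le> m" for s p
  proof -
    have "mono_on {..Suc p} (\<lambda>i. X (s + i))" by (auto intro!: mono_onI X_mono)
    moreover have "X (s + Suc p) - X (s + 0) < 2 * pi / freq h"
      using span X_mono[of 0 s] X_mono[OF that] by simp
    ultimately show ?thesis
      using tendsto_trig_dd[OF freq, of p "\<lambda>i. X (s + i)" t] unfolding spline by (simp only: add_0_right)
  qed
  have lim_left: "((\<lambda>y. trig_dd_distinct h (Suc n) y (trunc_sin_h h n t)) \<longlongrightarrow> trig_bspline h x j (Suc n) t)
      (left_nodes (Suc n) X)"
    and lim_right: "((\<lambda>y. trig_dd_distinct h (Suc n) y (trunc_sin_h h n t)) \<longlongrightarrow> trig_bspline h x (j + 1) (Suc n) t)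
      (left_nodes (Suc n) (\<lambda>k. X (Suc k)))"
    and lim_full: "((\<lambda>y. trig_dd_distinct h (Suc (Suc n)) y (trunc_sin_h h (Suc n) t)) \<longlongrightarrow> trig_bspline h x j m t)
      (left_nodes (Suc (Suc n)) X)"
    using lim[of 0 n] lim[of 1 n] lim[of 0 "Suc n"] by (simp_all add: m)
  have "X 0 < X (Suc (Suc n))" using assms by (simp add: X_def m)
  \<comment> \<open>The spline of order \<open>m\<close> and the right-hand side are limits of the same expression.\<close>
  note rec = tendsto_trig_dd_recurrence[OF freq span[unfolded m] this lim_left lim_right]
  have "left_nodes (Suc (Suc n)) X \<noteq> bot"
    by (rule left_nodes_neq_bot) (auto intro!: mono_onI X_mono)
  from tendsto_unique[OF this lim_full rec]
  show ?thesis
    by (simp add: half_sin_def X_def m algebra_simps)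
qed

end
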